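(* Let $n\ge3$ and let $A\in\mathbb{R}^{n\times n}$ be a nonsingular diagonal matrix. Let $q_A:\mathbb{S}^{n-1}\cap\mathbb{R}^n_{++}\to\mathbb{R}$, $q_A(x)=\langle Ax,x\rangle$. Then $q_A$ is merely spherically quasi-convex if and only if $A$ has only two distinct eigenvalues, such that its smallest one has multiplicity one and has a corresponding eigenvector with all components nonnegative.
   Context: $\langle\cdot,\cdot\rangle$ and $\|\cdot\|$ are the canonical inner product and norm on $\mathbb{R}^n$; $\mathbb{S}^{n-1}=\{x\in\mathbb{R}^n:\|x\|=1\}$ with intrinsic distance $d(x,y)=\arccos\langle x,y\rangle$; $\mathbb{R}^n_{++}$ is the set of vectors with all components positive. Standing assumption: $A$ has at least two distinct eigenvalues. "Only two distinct eigenvalues" means exactly two distinct eigenvalues. A minimal geodesic segment is a constant-speed parametrized arc of a great circle whose length equals the distance $d$ between its endpoints. A set $\mathcal{C}\subseteq\mathbb{S}^{n-1}$ is spherically convex if for any $x,y\in\mathcal{C}$ all minimal geodesic segments joining $x$ to $y$ are contained in $\mathcal{C}$; $\mathbb{S}^{n-1}\cap\mathbb{R}^n_{++}$ is spherically convex. A function $f:\mathcal{C}\to\mathbb{R}$ on a spherically convex set is spherically convex if for every minimal geodesic segment $\gamma:I\to\mathcal{C}$ ($I\subset\mathbb{R}$ an interval) the composition $f\circ\gamma:I\to\mathbb{R}$ is convex in the usual sense; it is spherically quasi-convex if for every such $\gamma$, $f(\gamma(t))\le\max\{f(\gamma(t_1)),f(\gamma(t_2))\}$ for all $t\in[t_1,t_2]\subset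 I$. A function is merely spherically quasi-convex if it is spherically quasi-convex but not spherically convex. *)

theory Defs
  imports "HOL-Analysis.Analysis" "HOL-Computational_Algebra.Polynomial"
begin

definition sphere_dist :: "real ^ 'n \<Rightarrow> real ^ 'n \<Rightarrow> real" where
  "sphere_dist x y = arccos (x \<bullet> y)"

text \<open>
  Every constant-speed parametrization of a great circle has the form
  \<open>t \<mapsto> cos (c t) u + sin (c t) v\<close> with \<open>u\<close>, \<open>v\<close> orthonormal (a phase shift and the
  orientation are absorbed in the choice of \<open>u\<close>, \<open>v\<close>). Its speed is \<open>c\<close>, so the length of
  the arc over \<open>{a..b}\<close> is \<open>c * (b - a)\<close>. Degenerate (constant) segments are included.
\<close>
definition minimal_geodesic_segment :: "real \<Rightarrow> real \<Rightarrow> (real \<Rightarrow> real ^ 'n) \<Rightarrow> bool" where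
  "minimal_geodesic_segment a b \<gamma> \<longleftrightarrow>
     a \<le> b \<and>
     (\<exists>u v c. norm u = 1 \<and> norm v = 1 \<and> u \<bullet> v = 0 \<and> 0 \<le> c \<and>
        (\<forall>t\<in>{a..b}. \<gamma> t = cos (c * t) *\<^sub>R u + sin (c * t) *\<^sub>R v) \<and>
        c * (b - a) = sphere_dist (\<gamma> a) (\<gamma> b))"

definition spherically_convex :: "(real ^ 'n) set \<Rightarrow> bool" where
  "spherically_convex C \<longleftrightarrow>
     C \<subseteq> sphere 0 1 \<and>
     (\<forall>x\<in>C. \<forall>y\<in>C. \<forall>a b \<gamma>. minimal_geodesic_segment a b \<gamma> \<and> \<gamma> a = x \<and> \<gamma> b = y \<longrightarrow>
        \<gamma> ` {a..b} \<subseteq> C)"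

definition spherically_convex_on :: "(real ^ 'n) set \<Rightarrow> (real ^ 'n \<Rightarrow> real) \<Rightarrow> bool" where
  "spherically_convex_on C f \<longleftrightarrow>
     spherically_convex C \<and>
     (\<forall>a b \<gamma>. minimal_geodesic_segment a b \<gamma> \<and> \<gamma> ` {a..b} \<subseteq> C \<longrightarrow> convex_on {a..b} (f \<circ> \<gamma>))"

definition spherically_quasiconvex_on :: "(real ^ 'n) set \<Rightarrow> (real ^ 'n \<Rightarrow> real) \<Rightarrow> bool" where
  "spherically_quasiconvex_on C f \<longleftrightarrow>
     spherically_convex C \<and>
     (\<forall>a b \<gamma>. minimal_geodesic_segment a b \<gamma> \<and> \<gamma> ` {a..b} \<subseteq> C \<longrightarrow>
        (\<forall>t1 t2. {t1..t2} \<subseteq> {a..b} \<longrightarrow>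
           (\<forall>t\<in>{t1..t2}. f (\<gamma> t) \<le> max (f (\<gamma> t1)) (f (\<gamma> t2)))))"

definition merely_spherically_quasiconvex_on ::
    "(real ^ 'n) set \<Rightarrow> (real ^ 'n \<Rightarrow> real) \<Rightarrow> bool" where
  "merely_spherically_quasiconvex_on C f \<longleftrightarrow>
     spherically_quasiconvex_on C f \<and> \<not> spherically_convex_on C f"

definition positive_orthant :: "(real ^ 'n) set" where
  "positive_orthant = {x. \<forall>i. 0 < x $ i}"

definition quad_form :: "real ^ 'n ^ 'n \<Rightarrow> real ^ 'n \<Rightarrow> real" where
  "quad_form A x = (A *v x) \<bullet> x"

definition diagonal_matrix :: "'a::zero ^ 'n ^ 'n \<Rightarrow> bool" where
  "diagonal_matrix A \<longleftrightarrow> (\<forall>i j. i \<noteq> j \<longrightarrow> A $ i $ j = 0)"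

definition is_eigenvector :: "real ^ 'n ^ 'n \<Rightarrow> real \<Rightarrow> real ^ 'n \<Rightarrow> bool" where
  "is_eigenvector A l v \<longleftrightarrow> v \<noteq> 0 \<and> A *v v = l *\<^sub>R v"

definition eigenvalues :: "real ^ 'n ^ 'n \<Rightarrow> real set" where
  "eigenvalues A = {l. \<exists>v. is_eigenvector A l v}"

definition charpoly :: "real ^ 'n ^ 'n \<Rightarrow> real poly" where
  "charpoly A = det (\<chi> i j. (if i = j then [:0, 1:] else 0) - [:A $ i $ j:])"

definition eigenvalue_multiplicity :: "real ^ 'n ^ 'n \<Rightarrow> real \<Rightarrow> nat" where
  "eigenvalue_multiplicity A l = order l (charpoly A)"

end

theory Submission
  imports Defs
begin

text \<open>
  Let \<open>d i\<close> be the diagonal entries of \<open>A\<close>. Quasi-convexity says that the cones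
  \<open>{x > 0. (\<Sum>i. (d i - c) * (x $ i)\<^sup>2) \<le> 0}\<close> are convex. If two entries \<open>d i\<close>, \<open>d j\<close> lie below
  a third one \<open>d k\<close>, this fails for \<open>c\<close> in between: the points \<open>s *\<^sub>R e i + e k\<close> and
  \<open>t *\<^sub>R e j + e k\<close> can be put strictly inside the cone while their sum is strictly outside, and a
  small perturbation makes them positive. Hence exactly one entry lies below the maximal one.
  Conversely, if \<open>d i = l\<close> and all other entries equal \<open>m > l\<close>, then
  \<open>quad_form A x = m - (m - l) * (x $ i)\<^sup>2\<close> on the sphere, and along a short geodesic \<open>x $ i\<close> is a
  positive sinusoid, hence quasi-concave; but \<open>- sin\<^sup>2\<close> is strictly concave on \<open>{0..pi/4}\<close>, so that
  \<open>quad_form A\<close> is not convex.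
\<close>

section \<open>Diagonal matrices\<close>

lemma diagonal_matrix_vector_mult:
  fixes A :: "real ^ 'n ^ 'n"
  assumes "diagonal_matrix A"
  shows "(A *v x) $ i = A $ i $ i * x $ i"
proof -
  have "(A *v x) $ i = (\<Sum>j\<in>UNIV. if j = i then A $ i $ i * x $ i else 0)"
    unfolding matrix_vector_mult_def vec_lambda_beta
    by (rule sum.cong) (use assms in \<open>auto simp: diagonal_matrix_def\<close>)
  then show ?thesis by simp
qed

lemma quad_form_diagonal:
  fixes A :: "real ^ 'n ^ 'n"
  assumes "diagonal_matrix A"
  shows "quad_form A x = (\<Sum>i\<in>UNIV. A $ i $ i * (x $ i)\<^sup>2)"
  unfolding quad_form_def inner_vec_def
  by (simp add: diagonal_matrix_vector_mult[OF assms] power2_eq_square mult.assoc)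

lemma is_eigenvector_axis:
  fixes A :: "real ^ 'n ^ 'n"
  assumes "diagonal_matrix A"
  shows "is_eigenvector A (A $ i $ i) (axis i 1)"
  unfolding is_eigenvector_def
  by (auto simp: vec_eq_iff diagonal_matrix_vector_mult[OF assms] axis_def)

lemma eigenvalues_diagonal:
  fixes A :: "real ^ 'n ^ 'n"
  assumes "diagonal_matrix A"
  shows "eigenvalues A = range (\<lambda>i. A $ i $ i)"
proof
  show "range (\<lambda>i. A $ i $ i) \<subseteq> eigenvalues A"
    using is_eigenvector_axis[OF assms] by (auto simp: eigenvalues_def)
  show "eigenvalues A \<subseteq> range (\<lambda>i. A $ i $ i)"
  proof
    fix l assume "l \<in> eigenvalues A"
    then obtain v where v: "v \<noteq> 0" "A *v v = l *\<^sub>R v"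
      by (auto simp: eigenvalues_def is_eigenvector_def)
    then obtain i where "v $ i \<noteq> 0" by (auto simp: vec_eq_iff)
    moreover have "A $ i $ i * v $ i = l * v $ i"
      using v(2) diagonal_matrix_vector_mult[OF assms, of v i] by (metis vector_scaleR_component real_scaleR_def)
    ultimately have "l = A $ i $ i" by simp
    then show "l \<in> range (\<lambda>i. A $ i $ i)" by simp
  qed
qed

text \<open>The order of a root is additive over nonzero products, and a linear factor contributes
  one exactly when its root is \<open>l\<close>. Applied to the characteristic polynomial, this
  turns multiplicities into counts of diagonal entries.\<close>

lemma order_prod_linear_factors:
  fixes d :: "'i \<Rightarrow> 'a::field"
  assumes "finite I"
  shows "order l (\<Prod>i\<in>I. [:- d i, 1:]) = card {i\<in>I. d i = l}"
  using assms
proof (induction I rule: finite_induct)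
  case empty
  then show ?case by simp
next
  case (insert i I)
  have nz: "[:- d i, 1:] * (\<Prod>i\<in>I. [:- d i, 1:]) \<noteq> 0"
    using insert.hyps by (simp del: mult_pCons_left)
  have "order l [:- d i, 1:] = (if d i = l then 1 else 0)"
    using order_power_n_n[of "d i" 1] by (auto intro!: order_0I)
  moreover have "{j \<in> insert i I. d j = l} =
      (if d i = l then insert i {j\<in>I. d j = l} else {j\<in>I. d j = l})"
    by auto
  ultimately show ?case
    using insert order_mult[OF nz] by simp
qed

lemma eigenvalue_multiplicity_diagonal:
  fixes A :: "real ^ 'n ^ 'n"
  assumes "diagonal_matrix A"
  shows "eigenvalue_multiplicity A l = card {i. A $ i $ i = l}"
proof -
  have "charpoly A = (\<Prod>i\<in>UNIV. [:- (A $ i $ i), 1:])"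
    unfolding charpoly_def
    by (subst det_diagonal) (use assms in \<open>auto simp: diagonal_matrix_def\<close>)
  then show ?thesis
    using order_prod_linear_factors[of "UNIV :: 'n set" l "\<lambda>i. A $ i $ i"]
    by (simp add: eigenvalue_multiplicity_def)
qed

section \<open>Geodesics in the positive orthant\<close>

text \<open>Spherical counterpart of linear interpolation: a sinusoid of frequency one is recovered
  from its values at two parameters.\<close>

lemma sinusoid_interpolation:
  fixes p q s s1 s2 :: real
  shows "sin (s2 - s1) * (cos s * p + sin s * q) =
    sin (s2 - s) * (cos s1 * p + sin s1 * q) + sin (s - s1) * (cos s2 * p + sin s2 * q)"
  by (simp add: sin_diff algebra_simps)

text \<open>Interpolation writes the value at \<open>s\<close> as a combination of the values at
  \<open>s1\<close> and \<open>s2\<close> with nonnegative weights. As sine is subadditive here, the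
  weights sum to at least one, so a nonnegative lower bound at both ends survives in
  between.\<close>

lemma sinusoid_ge:
  fixes p q s s1 s2 m :: real
  assumes "s1 \<le> s" "s \<le> s2" "s2 - s1 < pi" "0 \<le> m"
    and m1: "m \<le> cos s1 * p + sin s1 * q" and m2: "m \<le> cos s2 * p + sin s2 * q"
  shows "m \<le> cos s * p + sin s * q"
proof (cases "s1 = s2")
  case True
  then show ?thesis using assms by auto
next
  case False
  have pos: "0 \<le> sin (s2 - s)" "0 \<le> sin (s - s1)" "0 < sin (s2 - s1)"
    using assms False by (auto intro!: sin_ge_zero sin_gt_zero)
  \<comment> \<open>Subadditivity of sine: split \<open>s2 - s1\<close> at \<open>s\<close> and
    bound both cosines by 1.\<close>
  have "sin (s2 - s1) = sin (s2 - s) * cos (s - s1) + cos (s2 - s) * sin (s - s1)"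
    using sin_add[of "s2 - s" "s - s1"] by simp
  also have "\<dots> \<le> sin (s2 - s) * 1 + 1 * sin (s - s1)"
    using pos by (intro add_mono mult_left_mono mult_right_mono) auto
  finally have "m * sin (s2 - s1) \<le> m * (sin (s2 - s) + sin (s - s1))"
    using \<open>0 \<le> m\<close> by (simp add: mult_left_mono)
  also have "\<dots> \<le> sin (s2 - s) * (cos s1 * p + sin s1 * q)
      + sin (s - s1) * (cos s2 * p + sin s2 * q)"
    using mult_left_mono[OF m1 pos(1)] mult_left_mono[OF m2 pos(2)] by (simp add: algebra_simps)
  also have "\<dots> = (cos s * p + sin s * q) * sin (s2 - s1)"
    by (metis sinusoid_interpolation mult.commute)
  finally show ?thesis using pos(3) by simp
qed

lemma norm_great_circle:
  fixes u v :: "'a::real_inner"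
  assumes "norm u = 1" "norm v = 1" "u \<bullet> v = 0"
  shows "norm (cos s *\<^sub>R u + sin s *\<^sub>R v) = 1"
proof -
  have "(norm (cos s *\<^sub>R u + sin s *\<^sub>R v))\<^sup>2 = (cos s)\<^sup>2 + (sin s)\<^sup>2"
    using assms by (simp add: norm_add_Pythagorean power_mult_distrib orthogonal_def)
  then show ?thesis
    by (metis add.commute norm_ge_zero one_power2 power2_eq_imp_eq sin_cos_squared_add zero_le_one)
qed

lemma inner_great_circle:
  fixes u v :: "'a::real_inner"
  assumes "norm u = 1" "norm v = 1" "u \<bullet> v = 0"
  shows "(cos s *\<^sub>R u + sin s *\<^sub>R v) \<bullet> (cos t *\<^sub>R u + sin t *\<^sub>R v) = cos (t - s)"
  using assms
  by (simp add: inner_add_left inner_add_right inner_commute[of v u] dot_square_norm cos_diff)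

lemma great_circle_arc_minimal:
  fixes u v :: "real ^ 'n"
  assumes "norm u = 1" "norm v = 1" "u \<bullet> v = 0" "a \<le> b" "b - a \<le> pi"
  shows "minimal_geodesic_segment a b (\<lambda>t. cos t *\<^sub>R u + sin t *\<^sub>R v)"
  unfolding minimal_geodesic_segment_def sphere_dist_def inner_great_circle[OF assms(1-3)]
  using assms by (intro conjI exI[of _ u] exI[of _ v] exI[of _ 1]) (auto simp: arccos_cos)

lemma unit_positive_inner_bounds:
  assumes "x \<in> sphere 0 1 \<inter> positive_orthant" "y \<in> sphere 0 1 \<inter> positive_orthant"
  shows "0 \<le> x \<bullet> y" "x \<bullet> y \<le> 1"
proof -
  show "0 \<le> x \<bullet> y"
    using assms by (auto simp: inner_vec_def positive_orthant_def less_imp_le intro!: sum_nonneg)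
  show "x \<bullet> y \<le> 1"
    using assms norm_cauchy_schwarz[of x y] by auto
qed

text \<open>Each component of a geodesic is a sinusoid in \<open>c * t\<close>. Positive unit
  vectors have nonnegative inner product, so the whole segment spans an angle of at most
  \<open>pi / 2\<close> and \<open>sinusoid_ge\<close> applies. This gives both the convexity of the
  domain and the quasi-concavity of a single coordinate.\<close>

lemma positive_geodesic_component_ge:
  fixes \<gamma> :: "real \<Rightarrow> real ^ 'n"
  assumes geo: "minimal_geodesic_segment a b \<gamma>"
    and ends: "\<gamma> a \<in> sphere 0 1 \<inter> positive_orthant" "\<gamma> b \<in> sphere 0 1 \<inter> positive_orthant"
    and t: "a \<le> t1" "t1 \<le> t" "t \<le> t2" "t2 \<le> b"
    and m: "0 \<le> m" "m \<le> \<gamma> t1 $ i" "m \<le> \<gamma> t2 $ i"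
  shows "m \<le> \<gamma> t $ i"
proof -
  obtain u v c where c: "0 \<le> c"
    and \<gamma>: "\<And>t. t \<in> {a..b} \<Longrightarrow> \<gamma> t = cos (c * t) *\<^sub>R u + sin (c * t) *\<^sub>R v"
    and len: "c * (b - a) = sphere_dist (\<gamma> a) (\<gamma> b)"
    using geo unfolding minimal_geodesic_segment_def by blast
  have "c * t2 - c * t1 \<le> c * (b - a)"
    using c t mult_left_mono[of "t2 - t1" "b - a" c] by (simp add: algebra_simps)
  also have "\<dots> \<le> pi / 2"
    unfolding len sphere_dist_def using unit_positive_inner_bounds[OF ends] by (intro arccos_le_pi2)
  also have "\<dots> < pi" by simp
  finally show ?thesis
    using c t m \<gamma>[of t] \<gamma>[of t1] \<gamma>[of t2]
      sinusoid_ge[of "c * t1" "c * t" "c * t2" m "u $ i" "v $ i"]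
    by (simp add: mult_left_mono)
qed

lemma spherically_convex_positive_orthant:
  "spherically_convex (sphere 0 1 \<inter> positive_orthant :: (real ^ 'n) set)"
  unfolding spherically_convex_def
proof (intro conjI ballI allI impI; (elim conjE)?)
  fix x y :: "real ^ 'n" and a b \<gamma>
  assume ends: "x \<in> sphere 0 1 \<inter> positive_orthant" "y \<in> sphere 0 1 \<inter> positive_orthant"
    and geo: "minimal_geodesic_segment a b \<gamma>" and eqs: "\<gamma> a = x" "\<gamma> b = y"
  show "\<gamma> ` {a..b} \<subseteq> sphere 0 1 \<inter> positive_orthant"
  proof (rule image_subsetI)
    fix t assume "t \<in> {a..b}"
    then have t: "a \<le> t" "t \<le> b" by auto
    obtain u v c where "norm u = 1" "norm v = 1" "u \<bullet> v = 0"
      and "\<gamma> t = cos (c * t) *\<^sub>R u + sin (c * t) *\<^sub>R v"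
      using geo t unfolding minimal_geodesic_segment_def by (meson atLeastAtMost_iff)
    then have "norm (\<gamma> t) = 1" by (simp add: norm_great_circle)
    moreover have "0 < \<gamma> t $ i" for i
    proof -
      have "0 < min (x $ i) (y $ i)"
        using ends by (simp add: positive_orthant_def)
      also from this have "\<dots> \<le> \<gamma> t $ i"
        using positive_geodesic_component_ge[OF geo, of a t b "min (x $ i) (y $ i)" i] ends eqs t
        by simp
      finally show ?thesis .
    qed
    ultimately show "\<gamma> t \<in> sphere 0 1 \<inter> positive_orthant" by (simp add: positive_orthant_def)
  qed
qed simp

section \<open>Homogeneous form of quasi-convexity\<close>

text \<open>Gram-Schmidt turns \<open>x\<close>, \<open>y\<close> into an orthonormal pair
  \<open>x\<close>, \<open>v\<close>. The great circle from \<open>x\<close> towards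
  \<open>v\<close> meets \<open>y\<close> at angle \<open>arccos (x \<bullet> y)\<close>, and it
  remains to see that \<open>w\<close> is met no later.\<close>

lemma minimal_geodesic_through_combination:
  fixes x y :: "real ^ 'n"
  assumes x: "norm x = 1" and y: "norm y = 1" and xy: "0 \<le> x \<bullet> y" "x \<noteq> y"
    and coeffs: "0 \<le> \<kappa>" "0 \<le> \<mu>" and w: "norm w = 1" "w = \<kappa> *\<^sub>R x + \<mu> *\<^sub>R y"
  obtains b \<gamma> t where "minimal_geodesic_segment 0 b \<gamma>" "\<gamma> 0 = x" "\<gamma> b = y" "t \<in> {0..b}" "\<gamma> t = w"
proof -
  define k where "k = x \<bullet> y"
  define b where "b = arccos k"
  have "k < 1"
    using x y xy norm_cauchy_schwarz[of x y] norm_cauchy_schwarz_eq[of x y]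
    unfolding k_def by fastforce
  have k0: "0 \<le> k" using xy k_def by simp
  \<comment> \<open>\<open>r\<close> is the sine of the angle between \<open>x\<close> and
    \<open>y\<close>, that is, the norm of the part of \<open>y\<close> orthogonal to
    \<open>x\<close>.\<close>
  define r where "r = sqrt (1 - k\<^sup>2)"
  have k2: "k\<^sup>2 < 1" using \<open>k < 1\<close> k0 by (simp add: power_less_one_iff)
  have r: "0 < r" "r\<^sup>2 = 1 - k\<^sup>2" using k2 by (auto simp: r_def)
  define v where "v = (1 / r) *\<^sub>R (y - k *\<^sub>R x)"
  have xx: "x \<bullet> x = 1" "y \<bullet> y = 1" using x y by (simp_all add: dot_square_norm)
  have xv: "x \<bullet> v = 0"
    by (simp add: v_def inner_diff_right xx k_def)
  have "(y - k *\<^sub>R x) \<bullet> (y - k *\<^sub>R x) = r\<^sup>2"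
    by (simp add: r inner_diff_left inner_diff_right xx inner_commute[of y x]
        flip: k_def power2_eq_square)
  then have "norm (y - k *\<^sub>R x) = r" using r(1) by (simp add: norm_eq_sqrt_inner)
  then have v: "norm v = 1" using r by (simp add: v_def)
  have y_eq: "y = k *\<^sub>R x + r *\<^sub>R v" using r by (simp add: v_def)
  have cosb: "cos b = k" and sinb: "sin b = r"
    using \<open>k < 1\<close> k0 by (simp_all add: b_def r_def cos_arccos sin_arccos)
  have b: "0 \<le> b" "b \<le> pi"
    using \<open>k < 1\<close> k0 by (auto simp: b_def arccos_lbound arccos_ubound)
  define \<gamma> where "\<gamma> t = cos t *\<^sub>R x + sin t *\<^sub>R v" for t
  \<comment> \<open>\<open>\<alpha>\<close> equals \<open>x \<bullet> w\<close>, so \<open>w\<close>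
    should sit at angle \<open>arccos \<alpha>\<close>; this is at most \<open>b\<close> once
    \<open>k \<le> \<alpha>\<close>.\<close>
  define \<alpha> where "\<alpha> = \<kappa> + \<mu> * k"
  have w_eq: "w = \<alpha> *\<^sub>R x + (\<mu> * r) *\<^sub>R v"
    unfolding w(2) \<alpha>_def by (subst y_eq) (simp add: algebra_simps)
  have "\<alpha>\<^sup>2 + (\<mu> * r)\<^sup>2 = (norm w)\<^sup>2"
    unfolding w_eq using x v xv
    by (simp add: norm_add_Pythagorean orthogonal_def power_mult_distrib)
  then have sq: "(\<mu> * r)\<^sup>2 = 1 - \<alpha>\<^sup>2" using w by simp
  have "\<alpha>\<^sup>2 \<le> 1" using sq zero_le_power2[of "\<mu> * r"] by linarith
  then have \<alpha>: "-1 \<le> \<alpha>" "\<alpha> \<le> 1" using abs_square_le_1[of \<alpha>] by auto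
  have "1 \<le> \<kappa> + \<mu>"
    using norm_triangle_ineq[of "\<kappa> *\<^sub>R x" "\<mu> *\<^sub>R y"] w x y coeffs by simp
  then have "k \<le> k * \<kappa> + k * \<mu>" using mult_left_mono[of 1 "\<kappa> + \<mu>" k] k0
    by (simp add: algebra_simps)
  also have "\<dots> \<le> \<alpha>"
    using \<open>k < 1\<close> coeffs mult_right_mono[of k 1 \<kappa>] by (simp add: \<alpha>_def mult.commute)
  finally have "arccos \<alpha> \<le> b"
    unfolding b_def using \<alpha> k0 by (intro arccos_le_arccos) auto
  moreover have "\<gamma> (arccos \<alpha>) = w"
  proof -
    \<comment> \<open>The sign of \<open>\<mu> * r\<close> selects \<open>w\<close> rather than its
      mirror image across the line of \<open>x\<close>.\<close>
    have "sin (arccos \<alpha>) = \<mu> * r"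
      using \<alpha> r coeffs by (simp add: sin_arccos flip: sq)
    then show ?thesis using \<alpha> by (simp add: \<gamma>_def w_eq)
  qed
  moreover have "minimal_geodesic_segment 0 b \<gamma>"
    unfolding \<gamma>_def using x v xv b by (intro great_circle_arc_minimal) auto
  moreover have "\<gamma> 0 = x" "\<gamma> b = y" using y_eq by (simp_all add: \<gamma>_def cosb sinb)
  ultimately show ?thesis using that[of b \<gamma> "arccos \<alpha>"] \<alpha> by (simp add: arccos_lbound)
qed

lemma quad_form_scaleR: "quad_form A (r *\<^sub>R x) = r\<^sup>2 * quad_form A x"
  by (simp add: quad_form_def matrix_vector_mult_scaleR power2_eq_square)

text \<open>By homogeneity of degree two, a sublevel set on the sphere generates a cone. The
  normalized sum of \<open>p\<close> and \<open>q\<close> lies on a minimal geodesic between the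
  normalized \<open>p\<close> and \<open>q\<close>, so quasi-convexity makes this cone closed under
  addition.\<close>

lemma quasiconvex_quad_form_cone:
  fixes A :: "real ^ 'n ^ 'n"
  assumes qc: "spherically_quasiconvex_on (sphere 0 1 \<inter> positive_orthant) (quad_form A)"
    and pos: "p \<in> positive_orthant" "q \<in> positive_orthant"
    and le: "quad_form A p \<le> c * (norm p)\<^sup>2" "quad_form A q \<le> c * (norm q)\<^sup>2"
  shows "quad_form A (p + q) \<le> c * (norm (p + q))\<^sup>2"
proof -
  have pq: "p + q \<in> positive_orthant" using pos by (simp add: positive_orthant_def add_pos_pos)
  have nz: "0 < norm z" if "z \<in> positive_orthant" for z :: "real ^ 'n"
    using that by (auto simp: positive_orthant_def)
  define N where "N = norm (p + q)"
  have N: "0 < N" using nz[OF pq] by (simp add: N_def)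
  define x where "x = (1 / norm p) *\<^sub>R p"
  define y where "y = (1 / norm q) *\<^sub>R q"
  define w where "w = (1 / N) *\<^sub>R (p + q)"
  have x: "x \<in> sphere 0 1 \<inter> positive_orthant" and y: "y \<in> sphere 0 1 \<inter> positive_orthant"
    using pos nz[OF pos(1)] nz[OF pos(2)] by (auto simp: x_def y_def positive_orthant_def)
  have norms: "norm x = 1" "norm y = 1" "norm w = 1" using x y N by (auto simp: w_def N_def)
  have w: "w = (norm p / N) *\<^sub>R x + (norm q / N) *\<^sub>R y"
    using nz[OF pos(1)] nz[OF pos(2)] by (simp add: w_def x_def y_def scaleR_right_distrib)
  have fx: "quad_form A x \<le> c" and fy: "quad_form A y \<le> c"
    using le nz[OF pos(1)] nz[OF pos(2)]
    by (simp_all add: x_def y_def quad_form_scaleR power_divide divide_le_eq)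
  have "quad_form A w \<le> c"
  proof (cases "x = y")
    case True
    have "w = (norm p / N + norm q / N) *\<^sub>R x" using w True by (simp add: scaleR_left_distrib)
    moreover from this have "\<bar>norm p / N + norm q / N\<bar> = 1" using norms by simp
    ultimately show ?thesis using fx N by (simp add: abs_of_nonneg)
  next
    case False
    obtain b \<gamma> t where \<gamma>: "minimal_geodesic_segment 0 b \<gamma>" "\<gamma> 0 = x" "\<gamma> b = y" "t \<in> {0..b}" "\<gamma> t = w"
      using minimal_geodesic_through_combination[OF norms(1,2) _ False _ _ norms(3) w]
        unit_positive_inner_bounds[OF x y] N by auto
    then have "\<gamma> ` {0..b} \<subseteq> sphere 0 1 \<inter> positive_orthant"
      using spherically_convex_positive_orthant x y unfolding spherically_convex_def by blast
    then have "quad_form A w \<le> max (quad_form A x) (quad_form A y)"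
      using qc \<gamma> unfolding spherically_quasiconvex_on_def by blast
    then show ?thesis using fx fy by linarith
  qed
  then show ?thesis
    using N by (simp add: w_def quad_form_scaleR power_divide divide_le_eq N_def[symmetric])
qed

lemma quasiconvex_at_most_one_below:
  fixes A :: "real ^ 'n ^ 'n"
  assumes diag: "diagonal_matrix A"
    and qc: "spherically_quasiconvex_on (sphere 0 1 \<inter> positive_orthant) (quad_form A)"
    and below: "A $ i $ i < A $ k $ k" "A $ j $ j < A $ k $ k"
  shows "i = j"
proof (rule ccontr)
  assume "i \<noteq> j"
  \<comment> \<open>A level separating the two low entries from the high one.\<close>
  obtain c where c: "A $ i $ i < c" "A $ j $ j < c" "c < A $ k $ k"
    using dense[of "max (A $ i $ i) (A $ j $ j)" "A $ k $ k"] below by auto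
  have ne: "i \<noteq> k" "j \<noteq> k" using below by auto
  define F where "F x = quad_form A x - c * (norm x)\<^sup>2" for x
  have F: "F x = (\<Sum>h\<in>UNIV. (A $ h $ h - c) * (x $ h)\<^sup>2)" for x
    unfolding F_def quad_form_diagonal[OF diag] power2_norm_eq_inner inner_vec_def
    by (simp add: sum_distrib_left power2_eq_square left_diff_distrib flip: sum_subtractf)
  have F3: "F x = (A $ i $ i - c) * (x $ i)\<^sup>2 + (A $ j $ j - c) * (x $ j)\<^sup>2 + (A $ k $ k - c) * (x $ k)\<^sup>2"
    if "\<And>h. h \<notin> {i, j, k} \<Longrightarrow> x $ h = 0" for x
  proof -
    have "F x = (\<Sum>h\<in>{i, j, k}. (A $ h $ h - c) * (x $ h)\<^sup>2)"
      unfolding F using that by (intro sum.mono_neutral_right) auto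
    then show ?thesis using \<open>i \<noteq> j\<close> ne by simp
  qed
  \<comment> \<open>With \<open>K = A $ k $ k - c\<close>, the low coordinate contributes
    \<open>- 3/2 * K\<close>. Thus \<open>F p\<close> and \<open>F q\<close> equal
    \<open>K - 3/2 * K < 0\<close>, while in \<open>p + q\<close> the \<open>k\<close>-th component
    doubles and \<open>F (p + q) = 4 * K - 3 * K > 0\<close>. Any factor strictly between 1 and 2
    would do.\<close>
  define s where "s = sqrt (3 / 2 * (A $ k $ k - c) / (c - A $ i $ i))"
  define t where "t = sqrt (3 / 2 * (A $ k $ k - c) / (c - A $ j $ j))"
  have s: "0 \<le> s" "(A $ i $ i - c) * s\<^sup>2 = - (3 / 2 * (A $ k $ k - c))"
    and t: "0 \<le> t" "(A $ j $ j - c) * t\<^sup>2 = - (3 / 2 * (A $ k $ k - c))"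
    using c by (simp_all add: s_def t_def field_simps)
  define p where "p = axis i s + axis k (1::real)"
  define q where "q = axis j t + axis k (1::real)"
  have "F p < 0" "F q < 0" "0 < F (p + q)"
    using \<open>i \<noteq> j\<close> ne s t c by (subst F3; simp add: p_def q_def axis_def)+
  \<comment> \<open>\<open>p\<close> and \<open>q\<close> have zero components in general; a small
    multiple of the all-ones vector moves them into the open orthant, and continuity of
    \<open>F\<close> preserves the three strict inequalities.\<close>
  define P where "P \<epsilon> = p + \<epsilon> *\<^sub>R 1" for \<epsilon>
  define Q where "Q \<epsilon> = q + \<epsilon> *\<^sub>R 1" for \<epsilon>
  have lim: "((\<lambda>\<epsilon>. F (P \<epsilon>)) \<longlongrightarrow> F p) (at_right 0)" "((\<lambda>\<epsilon>. F (Q \<epsilon>)) \<longlongrightarrow> F q) (at_right 0)"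
    "((\<lambda>\<epsilon>. F (P \<epsilon> + Q \<epsilon>)) \<longlongrightarrow> F (p + q)) (at_right 0)"
    unfolding F P_def Q_def by (auto intro!: tendsto_eq_intros)
  have "\<forall>\<^sub>F \<epsilon> in at_right 0. F (P \<epsilon>) < 0 \<and> F (Q \<epsilon>) < 0 \<and> 0 < F (P \<epsilon> + Q \<epsilon>) \<and> (0::real) < \<epsilon>"
    using order_tendstoD(2)[OF lim(1) \<open>F p < 0\<close>] order_tendstoD(2)[OF lim(2) \<open>F q < 0\<close>]
      order_tendstoD(1)[OF lim(3) \<open>0 < F (p + q)\<close>] eventually_at_right_less[of 0]
    by eventually_elim simp
  then obtain \<epsilon> :: real where \<epsilon>: "F (P \<epsilon>) < 0" "F (Q \<epsilon>) < 0" "0 < F (P \<epsilon> + Q \<epsilon>)" "0 < \<epsilon>"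
    using eventually_happens by force
  have "P \<epsilon> \<in> positive_orthant" "Q \<epsilon> \<in> positive_orthant"
    using \<epsilon>(4) s(1) t(1) by (auto simp: P_def Q_def p_def q_def positive_orthant_def axis_def)
  then have "F (P \<epsilon> + Q \<epsilon>) \<le> 0"
    using quasiconvex_quad_form_cone[OF qc, of "P \<epsilon>" "Q \<epsilon>" c] \<epsilon> by (simp add: F_def)
  then show False using \<epsilon>(3) by simp
qed

section \<open>One entry below the others\<close>

text \<open>\<open>A\<close> is \<open>m\<close> times the identity minus a rank-one correction in
  direction \<open>i\<close>, and the identity part is constant on the sphere.\<close>

lemma quad_form_one_below:
  fixes A :: "real ^ 'n ^ 'n"
  assumes diag: "diagonal_matrix A" and m: "\<And>j. j \<noteq> i \<Longrightarrow> A $ j $ j = m"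
    and x: "norm x = 1"
  shows "quad_form A x = m - (m - A $ i $ i) * (x $ i)\<^sup>2"
proof -
  have "quad_form A x = (\<Sum>j\<in>UNIV. m * (x $ j)\<^sup>2 - (if j = i then (m - A $ i $ i) * (x $ i)\<^sup>2 else 0))"
    unfolding quad_form_diagonal[OF diag]
    by (rule sum.cong) (use m in \<open>auto simp: algebra_simps\<close>)
  also have "\<dots> = m * (norm x)\<^sup>2 - (m - A $ i $ i) * (x $ i)\<^sup>2"
    unfolding power2_norm_eq_inner inner_vec_def
    by (simp add: sum_subtractf sum_distrib_left power2_eq_square)
  finally show ?thesis using x by simp
qed

lemma quasiconvex_one_below:
  fixes A :: "real ^ 'n ^ 'n"
  assumes diag: "diagonal_matrix A" and m: "\<And>j. j \<noteq> i \<Longrightarrow> A $ j $ j = m" and less: "A $ i $ i < m"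
  shows "spherically_quasiconvex_on (sphere 0 1 \<inter> positive_orthant) (quad_form A)"
  unfolding spherically_quasiconvex_on_def
proof (intro conjI allI impI ballI spherically_convex_positive_orthant; elim conjE)
  fix a b t1 t2 t and \<gamma> :: "real \<Rightarrow> real ^ 'n"
  assume geo: "minimal_geodesic_segment a b \<gamma>"
    and img: "\<gamma> ` {a..b} \<subseteq> sphere 0 1 \<inter> positive_orthant"
    and sub: "{t1..t2} \<subseteq> {a..b}" and t: "t \<in> {t1..t2}"
  have ord: "a \<le> t1" "t1 \<le> t" "t \<le> t2" "t2 \<le> b" using sub t by auto
  have on: "\<gamma> \<tau> \<in> sphere 0 1 \<inter> positive_orthant" if "a \<le> \<tau>" "\<tau> \<le> b" for \<tau>
    using img that by (simp add: image_subset_iff)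
  \<comment> \<open>On the positive orthant the form decreases in the \<open>i\<close>-th component,
    so its larger end value occurs where that component is smaller.\<close>
  define h where "h = min (\<gamma> t1 $ i) (\<gamma> t2 $ i)"
  have h0: "0 \<le> h"
    using on[of t1] on[of t2] ord by (simp add: h_def positive_orthant_def less_imp_le)
  have "h \<le> \<gamma> t $ i"
    by (rule positive_geodesic_component_ge[OF geo on on ord]) (use ord h0 in \<open>auto simp: h_def\<close>)
  then have "(m - A $ i $ i) * h\<^sup>2 \<le> (m - A $ i $ i) * (\<gamma> t $ i)\<^sup>2"
    using less h0 by (intro mult_left_mono power_mono) auto
  moreover have "h = \<gamma> t1 $ i \<or> h = \<gamma> t2 $ i" by (auto simp: h_def)
  moreover have "quad_form A (\<gamma> \<tau>) = m - (m - A $ i $ i) * (\<gamma> \<tau> $ i)\<^sup>2" if "a \<le> \<tau>" "\<tau> \<le> b" for \<tau>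
    using on[OF that] by (intro quad_form_one_below[OF diag m]) auto
  ultimately show "quad_form A (\<gamma> t) \<le> max (quad_form A (\<gamma> t1)) (quad_form A (\<gamma> t2))"
    using ord by auto
qed

lemma not_convex_one_below:
  fixes A :: "real ^ 'n ^ 'n"
  assumes diag: "diagonal_matrix A" and m: "\<And>j. j \<noteq> i \<Longrightarrow> A $ j $ j = m" and less: "A $ i $ i < m"
    and "\<exists>j. j \<noteq> i"
  shows "\<not> spherically_convex_on (sphere 0 1 \<inter> positive_orthant) (quad_form A)"
proof
  assume convex: "spherically_convex_on (sphere 0 1 \<inter> positive_orthant) (quad_form A)"
  \<comment> \<open>\<open>z\<close> is the all-ones vector with component \<open>i\<close> removed.
    The great circle from \<open>u\<close> to the \<open>i\<close>-th axis has all other components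
    positive before the axis, and its \<open>i\<close>-th component is \<open>sin t\<close>.\<close>
  define z :: "real ^ 'n" where "z = 1 - axis i 1"
  define u where "u = (1 / norm z) *\<^sub>R z"
  define v :: "real ^ 'n" where "v = axis i 1"
  have "z \<noteq> 0" using \<open>\<exists>j. j \<noteq> i\<close> by (auto simp: z_def vec_eq_iff axis_def)
  then have uv: "norm u = 1" "norm v = 1" "u \<bullet> v = 0"
    by (simp_all add: u_def v_def z_def inner_axis)
  have ui: "u $ i = 0" and uj: "\<And>j. j \<noteq> i \<Longrightarrow> 0 < u $ j"
    using \<open>z \<noteq> 0\<close> by (simp_all add: u_def, simp_all add: z_def axis_def)
  define \<gamma> where "\<gamma> t = cos t *\<^sub>R u + sin t *\<^sub>R v" for t
  have norm: "norm (\<gamma> t) = 1" for t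
    unfolding \<gamma>_def using uv by (rule norm_great_circle)
  \<comment> \<open>The parameters avoid 0 and \<open>pi / 2\<close>, where the curve meets the
    boundary of the orthant. Their midpoint is \<open>pi / 6\<close>, and doubling the three angles
    gives \<open>pi / 6\<close>, \<open>pi / 3\<close> and \<open>pi / 2\<close>, whose cosines are
    known.\<close>
  have "\<gamma> ` {pi / 12..pi / 4} \<subseteq> sphere 0 1 \<inter> positive_orthant"
  proof (rule image_subsetI)
    fix t assume "t \<in> {pi / 12..pi / 4}"
    then have "0 < t" "t < pi / 2" using pi_gt_zero by (simp, linarith)+
    then have "0 < cos t" "0 < sin t" by (auto intro!: cos_gt_zero sin_gt_zero)
    then have "0 < \<gamma> t $ j" for j
      using uj[of j] ui by (cases "j = i") (simp_all add: \<gamma>_def v_def axis_def)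
    then show "\<gamma> t \<in> sphere 0 1 \<inter> positive_orthant" by (simp add: positive_orthant_def norm)
  qed
  moreover have "minimal_geodesic_segment (pi / 12) (pi / 4) \<gamma>"
    unfolding \<gamma>_def using uv by (intro great_circle_arc_minimal) auto
  ultimately have "convex_on {pi / 12..pi / 4} (quad_form A \<circ> \<gamma>)"
    using convex unfolding spherically_convex_on_def by blast
  from convex_onD[OF this, of "1/2" "pi / 12" "pi / 4"]
  have "quad_form A (\<gamma> (pi / 6)) \<le> (quad_form A (\<gamma> (pi / 12)) + quad_form A (\<gamma> (pi / 4))) / 2"
    by (simp add: field_simps)
  moreover have q: "quad_form A (\<gamma> t) = m - (m - A $ i $ i) * ((1 - cos (2 * t)) / 2)" for t
    using quad_form_one_below[OF diag m norm[of t]] ui cos_double_sin[of t]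
    by (simp add: \<gamma>_def v_def axis_def)
  ultimately have "(m - A $ i $ i) * cos (pi / 3) \<le> (m - A $ i $ i) * ((cos (pi / 6) + cos (pi / 2)) / 2)"
    by (simp add: q field_simps)
  \<comment> \<open>Midpoint convexity is now a claim about cosines alone; it says
    \<open>1 / 2 \<le> sqrt 3 / 4\<close>, which is false.\<close>
  then have "cos (pi / 3) \<le> (cos (pi / 6) + cos (pi / 2)) / 2"
    by (rule mult_left_le_imp_le) (use less in simp)
  then have "1 \<le> sqrt 3 / 2"
    by (simp add: cos_60 cos_30)
  moreover have "sqrt 3 < 2" by (rule real_less_lsqrt) auto
  ultimately show False by simp
qed

section \<open>Mere quasi-convexity in terms of the spectrum\<close>

theorem theorem5:
  fixes A :: "real ^ 'n ^ 'n"
  assumes "CARD('n) \<ge> 3"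
    and "diagonal_matrix A"
    and "invertible A"
    and "\<exists>l\<in>eigenvalues A. \<exists>m\<in>eigenvalues A. l \<noteq> m"
  shows "merely_spherically_quasiconvex_on (sphere 0 1 \<inter> positive_orthant) (quad_form A) \<longleftrightarrow>
    card (eigenvalues A) = 2 \<and>
    eigenvalue_multiplicity A (Min (eigenvalues A)) = 1 \<and>
    (\<exists>v. is_eigenvector A (Min (eigenvalues A)) v \<and> (\<forall>i. 0 \<le> v $ i))"
    (is "?L \<longleftrightarrow> ?R")
proof -
  note diag = assms(2)
  let ?d = "\<lambda>i. A $ i $ i"
  note ev = eigenvalues_diagonal[OF diag] and mult = eigenvalue_multiplicity_diagonal[OF diag]
  have not_const: "\<exists>i. ?d i \<noteq> l" for l
  proof (rule ccontr)
    assume "\<not> ?thesis"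
    then have "eigenvalues A = {l}" unfolding ev by auto
    then show False using assms(4) by simp
  qed
  show ?thesis
  proof
    assume ?L
    then have qc: "spherically_quasiconvex_on (sphere 0 1 \<inter> positive_orthant) (quad_form A)"
      by (simp add: merely_spherically_quasiconvex_on_def)
    \<comment> \<open>Compare with a maximal entry \<open>?d k\<close>: every entry different from
      it lies below it, and at most one index can do so.\<close>
    have "Max (range ?d) \<in> range ?d" by (rule Max_in) auto
    then obtain k where "Max (range ?d) = ?d k" by blast
    then have k: "?d j \<le> ?d k" for j
      using Max_ge[of "range ?d" "?d j"] by simp
    obtain i where "?d i \<noteq> ?d k"
      using not_const[of "?d k"] by blast
    then have i: "?d i < ?d k" using k[of i] by simp
    then have j: "?d j = ?d k" if "j \<noteq> i" for j
      using quasiconvex_at_most_one_below[OF diag qc, of i k j] k[of j] that by force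
    then have "?d h \<in> {?d i, ?d k}" for h by (cases "h = i") auto
    then have range: "range ?d = {?d i, ?d k}" by blast
    have Min: "Min (range ?d) = ?d i" using i range by simp
    have "{j. ?d j = ?d i} = {i}" using i j by force
    moreover have "card (range ?d) = 2" using i range by simp
    moreover have "\<forall>h. 0 \<le> axis i (1::real) $ h" by (simp add: axis_def)
    ultimately show ?R
      unfolding ev mult Min using is_eigenvector_axis[OF diag, of i]
      by (intro conjI exI[of _ "axis i 1"]) simp_all
  next
    assume ?R
    define l where "l = Min (range ?d)"
    have "card {i. ?d i = l} = 1" using \<open>?R\<close> unfolding ev mult l_def by simp
    then obtain i where i: "{i. ?d i = l} = {i}" by (auto simp: card_1_singleton_iff)
    have "?d i = l" using i by blast
    moreover obtain k where "?d k \<noteq> l"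
      using not_const[of l] by blast
    ultimately have "k \<noteq> i" by blast
    \<comment> \<open>Only \<open>i\<close> attains the minimum \<open>l\<close>, so with just two
      values available all other entries equal \<open>?d k\<close>.\<close>
    have "card (range ?d) = 2" using \<open>?R\<close> unfolding ev by simp
    moreover have "{l, ?d k} \<subseteq> range ?d" using \<open>?d i = l\<close> by blast
    ultimately have range: "range ?d = {l, ?d k}"
      using \<open>?d k \<noteq> l\<close> card_subset_eq[of "range ?d" "{l, ?d k}"] by simp
    have m: "?d j = ?d k" if "j \<noteq> i" for j
      using range i that by blast
    have "l \<le> ?d k" by (simp add: l_def)
    then have less: "?d i < ?d k" using \<open>?d i = l\<close> \<open>?d k \<noteq> l\<close> by simp
    show ?L
      unfolding merely_spherically_quasiconvex_on_def
      using quasiconvex_one_below[OF diag m less] not_convex_one_below[OF diag m less] \<open>k \<noteq> i\<close> by blast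
  qed
qed

end
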